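(* For every $p\in[1,\infty]$, $(\mathcal{U},d_{\mathrm{I},p})$ is not geodesic.
   Context: All metric spaces are nonempty. $\mathcal{U}$ is the collection of isometry classes of compact ultrametric spaces (metric spaces with $u(x,x'')\le\max(u(x,x'),u(x',x''))$ for all points). For $a,b\ge 0$: $a\boxplus_p b=(a^p+b^p)^{1/p}$ for $p<\infty$, $a\boxplus_\infty b=\max(a,b)$. For a compact ultrametric space $(X,u_X)$, the associated dendrogram $\theta_X$ assigns to $t\ge0$ the partition of $X$ into blocks $[x]^{\theta_X}_t=\{x':u_X(x,x')\le t\}$. For $\varepsilon>0$, $X$ and $Y$ are $(\varepsilon,p)$-interleaved if there exist set maps $\varphi:X\to Y$, $\psi:Y\to X$ such that for all $t\ge0$, $x\in X$, $y\in Y$: (1) $\varphi([x]^{\theta_X}_t)\subseteq[\varphi(x)]^{\theta_Y}_{t\boxplus_p\varepsilon}$ and $\psi([y]^{\theta_Y}_t)\subseteq[\psi(y)]^{\theta_X}_{t\boxplus_p\varepsilon}$; (2) $[x]^{\theta_X}_{t\boxplus_p\varepsilon\boxplus_p\varepsilon}=[\psi\circ\varphi(x)]^{\theta_X}_{t\boxplus_p\varepsilon\boxplus_p\varepsilon}$ and $[y]^{\theta_Y}_{t\boxplus_p\varepsilon\boxplus_p\varepsilon}=[\varphi\circ\psi(y)]^{\theta_Y}_{t\boxplus_p\varepsilon\boxplus_p\varepsilon}$. The $p$-interleaving distance is $d_{\mathrm{I},p}(X,Y)=\inf\{\varepsilon>0: X,Y\text{ are }(\varepsilon,p)\text{-interleaved}\}$.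 A space $(W,d)$ is geodesic if any two points $w,w'\in W$ are joined by a continuous curve $\gamma:[0,1]\to W$ with $\gamma(0)=w$, $\gamma(1)=w'$ and $d(\gamma(s),\gamma(t))=|s-t|\,d(w,w')$ for all $s,t\in[0,1]$. *)

theory Defs
  imports "HOL-Analysis.Analysis"
begin

text \<open>The exponent ranges over the extended reals, so that \<open>p = \<infinity>\<close> is covered; it is meant
  for \<open>1 \<le> p\<close> and \<open>a, b \<ge> 0\<close>. Note that \<open>0 powr x = 0\<close>.\<close>

definition psum :: "ereal \<Rightarrow> real \<Rightarrow> real \<Rightarrow> real" where
  "psum p a b =
    (if p = \<infinity> then max a b
     else (a powr real_of_ereal p + b powr real_of_ereal p) powr (1 / real_of_ereal p))"

definition compact_ultrametric :: "'a metric \<Rightarrow> bool" where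
  "compact_ultrametric X \<longleftrightarrow>
    mspace X \<noteq> {} \<and> compact_space (mtopology_of X) \<and>
    (\<forall>x\<in>mspace X. \<forall>x'\<in>mspace X. \<forall>x''\<in>mspace X.
      mdist X x x'' \<le> max (mdist X x x') (mdist X x' x''))"

definition isometric :: "'a metric \<Rightarrow> 'b metric \<Rightarrow> bool" where
  "isometric X Y \<longleftrightarrow>
    (\<exists>f. bij_betw f (mspace X) (mspace Y) \<and>
      (\<forall>x\<in>mspace X. \<forall>x'\<in>mspace X. mdist Y (f x) (f x') = mdist X x x'))"

text \<open>The block of \<open>x\<close> at height \<open>t\<close> in the dendrogram of \<open>X\<close>.\<close>

definition dblock :: "'a metric \<Rightarrow> real \<Rightarrow> 'a \<Rightarrow> 'a set" where
  "dblock X t x = {x' \<in> mspace X. mdist X x x' \<le> t}"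

definition interleaved :: "ereal \<Rightarrow> real \<Rightarrow> 'a metric \<Rightarrow> 'b metric \<Rightarrow> bool" where
  "interleaved p \<epsilon> X Y \<longleftrightarrow>
    (\<exists>\<phi> \<psi>. \<phi> \<in> mspace X \<rightarrow> mspace Y \<and> \<psi> \<in> mspace Y \<rightarrow> mspace X \<and>
      (\<forall>t\<ge>0. \<forall>x\<in>mspace X. \<forall>y\<in>mspace Y.
        \<phi> ` dblock X t x \<subseteq> dblock Y (psum p t \<epsilon>) (\<phi> x) \<and>
        \<psi> ` dblock Y t y \<subseteq> dblock X (psum p t \<epsilon>) (\<psi> y) \<and>
        dblock X (psum p (psum p t \<epsilon>) \<epsilon>) x = dblock X (psum p (psum p t \<epsilon>) \<epsilon>) (\<psi> (\<phi> x)) \<and>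
        dblock Y (psum p (psum p t \<epsilon>) \<epsilon>) y = dblock Y (psum p (psum p t \<epsilon>) \<epsilon>) (\<phi> (\<psi> y))))"

text \<open>The set below is bounded below by \<open>0\<close>, and for compact ultrametric spaces and \<open>1 \<le> p\<close> it is
  nonempty because compact spaces have finite diameter, so the real-valued infimum is the intended one.\<close>

definition interleaving_distance :: "ereal \<Rightarrow> 'a metric \<Rightarrow> 'b metric \<Rightarrow> real" where
  "interleaving_distance p X Y = Inf {\<epsilon>. \<epsilon> > 0 \<and> interleaved p \<epsilon> X Y}"

lemma isometric_refl: "isometric X X"
  unfolding isometric_def by (rule exI[of _ id]) auto

lemma isometric_inverse:
  assumes "isometric X Y"
  obtains f g where "f \<in> mspace X \<rightarrow> mspace Y" "g \<in> mspace Y \<rightarrow> mspace X"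
    "\<And>x. x \<in> mspace X \<Longrightarrow> g (f x) = x" "\<And>y. y \<in> mspace Y \<Longrightarrow> f (g y) = y"
    "\<And>x x'. x \<in> mspace X \<Longrightarrow> x' \<in> mspace X \<Longrightarrow> mdist Y (f x) (f x') = mdist X x x'"
    "\<And>y y'. y \<in> mspace Y \<Longrightarrow> y' \<in> mspace Y \<Longrightarrow> mdist X (g y) (g y') = mdist Y y y'"
proof -
  obtain f where f: "bij_betw f (mspace X) (mspace Y)"
    and d: "\<And>x x'. x \<in> mspace X \<Longrightarrow> x' \<in> mspace X \<Longrightarrow> mdist Y (f x) (f x') = mdist X x x'"
    using assms unfolding isometric_def by blast
  define g where "g = inv_into (mspace X) f"
  have 1: "f \<in> mspace X \<rightarrow> mspace Y" using f bij_betwE by blast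
  have 2: "g \<in> mspace Y \<rightarrow> mspace X"
    unfolding g_def using f bij_betw_inv_into bij_betwE by blast
  have 3: "g (f x) = x" if "x \<in> mspace X" for x
    unfolding g_def using f that by (rule bij_betw_inv_into_left)
  have 4: "f (g y) = y" if "y \<in> mspace Y" for y
    unfolding g_def using f that by (rule bij_betw_inv_into_right)
  have 5: "mdist X (g y) (g y') = mdist Y y y'" if "y \<in> mspace Y" "y' \<in> mspace Y" for y y'
    using d[of "g y" "g y'"] 2 4 that by (auto simp: Pi_iff)
  show ?thesis using that[OF 1 2 3 4 d 5] by blast
qed

lemma isometric_sym:
  assumes "isometric X Y" shows "isometric Y X"
proof -
  obtain f g where f: "f \<in> mspace X \<rightarrow> mspace Y" and g: "g \<in> mspace Y \<rightarrow> mspace X"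
    and gf: "\<And>x. x \<in> mspace X \<Longrightarrow> g (f x) = x" and fg: "\<And>y. y \<in> mspace Y \<Longrightarrow> f (g y) = y"
    and df: "\<And>x x'. x \<in> mspace X \<Longrightarrow> x' \<in> mspace X \<Longrightarrow> mdist Y (f x) (f x') = mdist X x x'"
    and dg: "\<And>y y'. y \<in> mspace Y \<Longrightarrow> y' \<in> mspace Y \<Longrightarrow> mdist X (g y) (g y') = mdist Y y y'"
    by (rule isometric_inverse[OF assms]) (rule that)
  from f g gf fg dg show ?thesis
    unfolding isometric_def by (intro exI[of _ g] conjI bij_betw_byWitness[where f'=f]) auto
qed

lemma isometric_trans:
  assumes "isometric X Y" "isometric Y Z" shows "isometric X Z"
proof -
  obtain f where f: "bij_betw f (mspace X) (mspace Y)"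
    "\<forall>x\<in>mspace X. \<forall>x'\<in>mspace X. mdist Y (f x) (f x') = mdist X x x'"
    using assms(1) unfolding isometric_def by blast
  obtain g where g: "bij_betw g (mspace Y) (mspace Z)"
    "\<forall>x\<in>mspace Y. \<forall>x'\<in>mspace Y. mdist Z (g x) (g x') = mdist Y x x'"
    using assms(2) unfolding isometric_def by blast
  show ?thesis unfolding isometric_def
  proof (intro exI[of _ "g \<circ> f"] conjI ballI)
    show "bij_betw (g \<circ> f) (mspace X) (mspace Z)" using f(1) g(1) by (rule bij_betw_trans)
    show "mdist Z ((g \<circ> f) x) ((g \<circ> f) x') = mdist X x x'"
      if "x \<in> mspace X" "x' \<in> mspace X" for x x'
      using f g that bij_betwE[OF f(1)] by simp
  qed
qed

text \<open>A compact metric space has at most the cardinality of the continuum. Hence compact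
  ultrametric spaces with carrier a set of reals represent all isometry classes; the lemma
  \<open>compact_ultrametric_real\<close> below proves this.\<close>

definition isometric_cu :: "real metric \<Rightarrow> real metric \<Rightarrow> bool" where
  "isometric_cu X Y \<longleftrightarrow> compact_ultrametric X \<and> compact_ultrametric Y \<and> isometric X Y"

lemma compact_ultrametric_isometric:
  assumes "compact_ultrametric X" "isometric X Y"
  shows "compact_ultrametric Y"
proof -
  obtain f g where f: "f \<in> mspace X \<rightarrow> mspace Y" and g: "g \<in> mspace Y \<rightarrow> mspace X"
    and gf: "\<And>x. x \<in> mspace X \<Longrightarrow> g (f x) = x" and fg: "\<And>y. y \<in> mspace Y \<Longrightarrow> f (g y) = y"
    and df: "\<And>x x'. x \<in> mspace X \<Longrightarrow> x' \<in> mspace X \<Longrightarrow> mdist Y (f x) (f x') = mdist X x x'"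
    and dg: "\<And>y y'. y \<in> mspace Y \<Longrightarrow> y' \<in> mspace Y \<Longrightarrow> mdist X (g y) (g y') = mdist Y y y'"
    by (rule isometric_inverse[OF assms(2)]) (rule that)
  have im: "f ` mspace X = mspace Y" using f g fg by (force simp: Pi_iff)
  interpret M: Metric_space12 "mspace X" "mdist X" "mspace Y" "mdist Y"
    by (simp add: Metric_space12_def)
  have "homeomorphic_map (mtopology_of X) (mtopology_of Y) f"
    unfolding mtopology_of_def using im df by (intro M.isometry_imp_homeomorphic_map) auto
  then have "compact_space (mtopology_of Y)"
    using assms(1) homeomorphic_compact_space homeomorphic_map_imp_homeomorphic_space
    unfolding compact_ultrametric_def by blast
  moreover have "mdist Y x x'' \<le> max (mdist Y x x') (mdist Y x' x'')"
    if "x \<in> mspace Y" "x' \<in> mspace Y" "x'' \<in> mspace Y" for x x' x''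
  proof -
    have "g x \<in> mspace X" "g x' \<in> mspace X" "g x'' \<in> mspace X" using g that by auto
    then have "mdist X (g x) (g x'') \<le> max (mdist X (g x) (g x')) (mdist X (g x') (g x''))"
      using assms(1) unfolding compact_ultrametric_def by blast
    then show ?thesis using dg that by simp
  qed
  moreover have "mspace Y \<noteq> {}" using assms(1) im unfolding compact_ultrametric_def by auto
  ultimately show ?thesis unfolding compact_ultrametric_def by blast
qed

lemma compact_ultrametric_real:
  fixes X :: "'a metric"
  assumes "compact_ultrametric X"
  obtains Y :: "real metric" where "compact_ultrametric Y" "isometric X Y"
proof -
  interpret M: Metric_space "mspace X" "mdist X" by simp
  have "M.mtotally_bounded (mspace X)"
    using assms M.compact_space_eq_mcomplete_mtotally_bounded
    unfolding compact_ultrametric_def mtopology_of_def by blast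
  then have "\<exists>K. finite K \<and> K \<subseteq> mspace X \<and> mspace X \<subseteq> (\<Union>x\<in>K. M.mball x (inverse (Suc n)))" for n
    unfolding M.mtotally_bounded_def by auto
  then obtain K where K: "\<And>n. finite (K n)" "\<And>n. K n \<subseteq> mspace X"
    "\<And>n. mspace X \<subseteq> (\<Union>x\<in>K n. M.mball x (inverse (Suc n)))" by metis
  define Q where "Q = (\<Union>n. K n) \<times> (UNIV :: nat set)"
  have cQ: "countable Q" unfolding Q_def using K(1) by (auto intro: countable_finite)
  define h where "h x = to_nat_on Q ` {(q, n). (q, n) \<in> Q \<and> mdist X q x < inverse (Suc n)}" for x
  have inj_h: "inj_on h (mspace X)"
  proof (rule inj_onI, rule ccontr)
    fix x y assume xy: "x \<in> mspace X" "y \<in> mspace X" "h x = h y" "x \<noteq> y"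
    then have "mdist X x y > 0" by simp
    then obtain n where n: "inverse (real (Suc n)) < mdist X x y / 2"
      using reals_Archimedean half_gt_zero by metis
    obtain q where q: "q \<in> K n" "q \<in> mspace X" "mdist X q x < inverse (Suc n)"
      using K(3)[of n] xy(1) by fastforce
    have "{(q, n). (q, n) \<in> Q \<and> mdist X q x < inverse (Suc n)}
        = {(q, n). (q, n) \<in> Q \<and> mdist X q y < inverse (Suc n)}"
      using xy(3) inj_on_to_nat_on[OF cQ] unfolding h_def
      by (subst (asm) inj_on_image_eq_iff) auto
    moreover have "(q, n) \<in> Q" using q(1) by (auto simp: Q_def)
    ultimately have "mdist X q y < inverse (Suc n)" using q(3) by blast
    moreover have "mdist X x y \<le> mdist X q x + mdist X q y"
      using mdist_triangle[of x X q y] xy q(2) mdist_commute[of X x q] by simp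
    ultimately show False using n q(3) by linarith
  qed
  obtain e :: "nat set \<Rightarrow> real" where e: "inj e"
    using nat_sets_eqpoll_reals unfolding eqpoll_def by (auto dest: bij_betw_imp_inj_on)
  define f where "f = e \<circ> h"
  have inj: "inj_on f (mspace X)"
    unfolding f_def using inj_h e by (auto intro: comp_inj_on inj_on_subset)
  define g where "g = inv_into (mspace X) f"
  have gf: "g (f x) = x" if "x \<in> mspace X" for x using that inj by (simp add: g_def)
  have gi: "g r \<in> mspace X" if "r \<in> f ` mspace X" for r using that gf by auto
  define d where "d a b = (if a \<in> f ` mspace X \<and> b \<in> f ` mspace X then mdist X (g a) (g b) else 0)"
    for a b
  have "Metric_space (f ` mspace X) d"
  proof
    show "0 \<le> d x y" for x y by (simp add: d_def)
    show "d x y = d y x" for x y by (simp add: d_def mdist_commute)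
    show "(d x y = 0) = (x = y)" if "x \<in> f ` mspace X" "y \<in> f ` mspace X" for x y
      using that gf by (auto simp: d_def)
    show "d x z \<le> d x y + d y z"
      if "x \<in> f ` mspace X" "y \<in> f ` mspace X" "z \<in> f ` mspace X" for x y z
      using that gi by (auto simp: d_def intro: mdist_triangle)
  qed
  then interpret Y: Metric_space "f ` mspace X" d .
  have iso: "isometric X (metric (f ` mspace X, d))"
    unfolding isometric_def using inj gf
    by (intro exI[of _ f]) (auto simp: d_def bij_betw_def)
  then show ?thesis using that compact_ultrametric_isometric[OF assms] by blast
qed

lemma interleaved_isometric_left:
  assumes "interleaved p \<epsilon> X Y" "isometric X X'"
  shows "interleaved p \<epsilon> X' Y"
proof -
  obtain \<phi> \<psi> where \<phi>: "\<phi> \<in> mspace X \<rightarrow> mspace Y" and \<psi>: "\<psi> \<in> mspace Y \<rightarrow> mspace X"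
    and all: "\<forall>t\<ge>0. \<forall>x\<in>mspace X. \<forall>y\<in>mspace Y.
        \<phi> ` dblock X t x \<subseteq> dblock Y (psum p t \<epsilon>) (\<phi> x) \<and>
        \<psi> ` dblock Y t y \<subseteq> dblock X (psum p t \<epsilon>) (\<psi> y) \<and>
        dblock X (psum p (psum p t \<epsilon>) \<epsilon>) x = dblock X (psum p (psum p t \<epsilon>) \<epsilon>) (\<psi> (\<phi> x)) \<and>
        dblock Y (psum p (psum p t \<epsilon>) \<epsilon>) y = dblock Y (psum p (psum p t \<epsilon>) \<epsilon>) (\<phi> (\<psi> y))"
    using assms(1) unfolding interleaved_def by (elim exE conjE) (rule that)
  obtain f g where f: "f \<in> mspace X \<rightarrow> mspace X'" and g: "g \<in> mspace X' \<rightarrow> mspace X"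
    and gf: "\<And>x. x \<in> mspace X \<Longrightarrow> g (f x) = x" and fg: "\<And>y. y \<in> mspace X' \<Longrightarrow> f (g y) = y"
    and df: "\<And>x x'. x \<in> mspace X \<Longrightarrow> x' \<in> mspace X \<Longrightarrow> mdist X' (f x) (f x') = mdist X x x'"
    and dg: "\<And>y y'. y \<in> mspace X' \<Longrightarrow> y' \<in> mspace X' \<Longrightarrow> mdist X (g y) (g y') = mdist X' y y'"
    by (rule isometric_inverse[OF assms(2)]) (rule that)
  have fb: "dblock X' r (f x) = f ` dblock X r x" if "x \<in> mspace X" for r x
  proof
    show "f ` dblock X r x \<subseteq> dblock X' r (f x)"
      using f df that by (auto simp: dblock_def)
    show "dblock X' r (f x) \<subseteq> f ` dblock X r x"
    proof
      fix z assume z: "z \<in> dblock X' r (f x)"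
      then have "z \<in> mspace X'" by (simp add: dblock_def)
      then have "z = f (g z)" "g z \<in> mspace X" using fg g by auto
      moreover from this have "g z \<in> dblock X r x"
        using z df[OF that, of "g z"] by (simp add: dblock_def)
      ultimately show "z \<in> f ` dblock X r x" by blast
    qed
  qed
  have gb: "g ` dblock X' r x = dblock X r (g x)" if "x \<in> mspace X'" for r x
  proof -
    have "dblock X' r x = f ` dblock X r (g x)" using fb[of "g x" r] g fg that by auto
    moreover have "g ` f ` dblock X r (g x) = dblock X r (g x)"
      using gf by (force simp: dblock_def image_image)
    ultimately show ?thesis by simp
  qed
  show ?thesis unfolding interleaved_def
  proof (intro exI[of _ "\<phi> \<circ> g"] exI[of _ "f \<circ> \<psi>"] conjI allI impI ballI)
    show "\<phi> \<circ> g \<in> mspace X' \<rightarrow> mspace Y" "f \<circ> \<psi> \<in> mspace Y \<rightarrow> mspace X'"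
      using \<phi> \<psi> f g by auto
    fix t :: real and x y assume t: "0 \<le> t" and x: "x \<in> mspace X'" and y: "y \<in> mspace Y"
    have gx: "g x \<in> mspace X" and py: "\<psi> y \<in> mspace X" and ppx: "\<psi> (\<phi> (g x)) \<in> mspace X"
      using g \<phi> \<psi> x y by auto
    note 1 = all[rule_format, OF t gx y]
    show "(\<phi> \<circ> g) ` dblock X' t x \<subseteq> dblock Y (psum p t \<epsilon>) ((\<phi> \<circ> g) x)"
      using conjunct1[OF 1] unfolding image_comp[symmetric] gb[OF x] by simp
    show "(f \<circ> \<psi>) ` dblock Y t y \<subseteq> dblock X' (psum p t \<epsilon>) ((f \<circ> \<psi>) y)"
      using image_mono[OF conjunct1[OF conjunct2[OF 1]], of f] fb[OF py] unfolding image_comp[symmetric] by simp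
    show "dblock X' (psum p (psum p t \<epsilon>) \<epsilon>) x
        = dblock X' (psum p (psum p t \<epsilon>) \<epsilon>) ((f \<circ> \<psi>) ((\<phi> \<circ> g) x))"
      using conjunct1[OF conjunct2[OF conjunct2[OF 1]]] fb[OF gx] fb[OF ppx] fg[OF x] by simp
    show "dblock Y (psum p (psum p t \<epsilon>) \<epsilon>) y
        = dblock Y (psum p (psum p t \<epsilon>) \<epsilon>) ((\<phi> \<circ> g) ((f \<circ> \<psi>) y))"
      using conjunct2[OF conjunct2[OF conjunct2[OF 1]]] gf[OF py] by simp
  qed
qed

lemma interleaved_sym:
  assumes "interleaved p \<epsilon> X Y" shows "interleaved p \<epsilon> Y X"
proof -
  obtain \<phi> \<psi> where 1: "\<phi> \<in> mspace X \<rightarrow> mspace Y" "\<psi> \<in> mspace Y \<rightarrow> mspace X"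
    and all: "\<forall>t\<ge>0. \<forall>x\<in>mspace X. \<forall>y\<in>mspace Y.
        \<phi> ` dblock X t x \<subseteq> dblock Y (psum p t \<epsilon>) (\<phi> x) \<and>
        \<psi> ` dblock Y t y \<subseteq> dblock X (psum p t \<epsilon>) (\<psi> y) \<and>
        dblock X (psum p (psum p t \<epsilon>) \<epsilon>) x = dblock X (psum p (psum p t \<epsilon>) \<epsilon>) (\<psi> (\<phi> x)) \<and>
        dblock Y (psum p (psum p t \<epsilon>) \<epsilon>) y = dblock Y (psum p (psum p t \<epsilon>) \<epsilon>) (\<phi> (\<psi> y))"
    using assms unfolding interleaved_def by (elim exE conjE) (rule that)
  show ?thesis unfolding interleaved_def
  proof (intro exI[of _ \<psi>] exI[of _ \<phi>] conjI allI impI ballI 1)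
    fix t :: real and y x assume "0 \<le> t" "y \<in> mspace Y" "x \<in> mspace X"
    note a = all[rule_format, OF this(1,3,2)]
    show "\<psi> ` dblock Y t y \<subseteq> dblock X (psum p t \<epsilon>) (\<psi> y)"
      by (rule conjunct1[OF conjunct2[OF a]])
    show "\<phi> ` dblock X t x \<subseteq> dblock Y (psum p t \<epsilon>) (\<phi> x)"
      by (rule conjunct1[OF a])
    show "dblock Y (psum p (psum p t \<epsilon>) \<epsilon>) y = dblock Y (psum p (psum p t \<epsilon>) \<epsilon>) (\<phi> (\<psi> y))"
      by (rule conjunct2[OF conjunct2[OF conjunct2[OF a]]])
    show "dblock X (psum p (psum p t \<epsilon>) \<epsilon>) x = dblock X (psum p (psum p t \<epsilon>) \<epsilon>) (\<psi> (\<phi> x))"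
      by (rule conjunct1[OF conjunct2[OF conjunct2[OF a]]])
  qed
qed

lemma interleaving_distance_isometric:
  assumes "isometric X X'" "isometric Y Y'"
  shows "interleaving_distance p X Y = interleaving_distance p X' Y'"
proof -
  have "interleaved p \<epsilon> X Y \<longleftrightarrow> interleaved p \<epsilon> X' Y'" for \<epsilon>
  proof
    assume "interleaved p \<epsilon> X Y"
    from interleaved_isometric_left[OF this assms(1)] have "interleaved p \<epsilon> Y X'"
      by (rule interleaved_sym)
    from interleaved_isometric_left[OF this assms(2)] show "interleaved p \<epsilon> X' Y'"
      by (rule interleaved_sym)
  next
    assume "interleaved p \<epsilon> X' Y'"
    from interleaved_isometric_left[OF this isometric_sym[OF assms(1)]]
    have "interleaved p \<epsilon> Y' X" by (rule interleaved_sym)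
    from interleaved_isometric_left[OF this isometric_sym[OF assms(2)]]
    show "interleaved p \<epsilon> X Y" by (rule interleaved_sym)
  qed
  then show ?thesis by (simp add: interleaving_distance_def)
qed

text \<open>The collection of isometry classes of compact ultrametric spaces, and the interleaving
  distance on it.\<close>

quotient_type ultra_class = "real metric" / partial: isometric_cu
proof (rule part_equivpI)
  let ?P = "submetric (euclidean_metric :: real metric) {0}"
  have "compact_space (mtopology_of ?P)"
    by (simp add: mtopology_of_submetric compact_space_subtopology)
  then have "compact_ultrametric ?P" by (simp add: compact_ultrametric_def)
  then show "\<exists>X. isometric_cu X X" using isometric_refl unfolding isometric_cu_def by blast
  show "symp isometric_cu" by (auto simp: symp_def isometric_cu_def intro: isometric_sym)
  show "transp isometric_cu" by (auto simp: transp_def isometric_cu_def intro: isometric_trans)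
qed

lift_definition class_distance :: "ereal \<Rightarrow> ultra_class \<Rightarrow> ultra_class \<Rightarrow> real"
  is interleaving_distance
  by (auto simp: isometric_cu_def intro: interleaving_distance_isometric)

text \<open>Continuity of \<open>\<gamma>\<close> with respect to \<open>d\<close> is written with \<open>\<epsilon>\<close> and \<open>\<delta>\<close>, so that
  the definition does not presuppose that \<open>d\<close> has been shown to be a metric.\<close>

definition geodesic_space :: "'a set \<Rightarrow> ('a \<Rightarrow> 'a \<Rightarrow> real) \<Rightarrow> bool" where
  "geodesic_space W d \<longleftrightarrow>
    (\<forall>w\<in>W. \<forall>w'\<in>W. \<exists>\<gamma> :: real \<Rightarrow> 'a. \<gamma> \<in> {0..1} \<rightarrow> W \<and>
      (\<forall>s\<in>{0..1}. \<forall>\<epsilon>>0. \<exists>\<delta>>0. \<forall>t\<in>{0..1}. \<bar>t - s\<bar> < \<delta> \<longrightarrow> d (\<gamma> s) (\<gamma> t) < \<epsilon>) \<and>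
      \<gamma> 0 = w \<and> \<gamma> 1 = w' \<and>
      (\<forall>s\<in>{0..1}. \<forall>t\<in>{0..1}. d (\<gamma> s) (\<gamma> t) = \<bar>s - t\<bar> * d w w'))"

end

theory Submission
  imports Defs
begin

text \<open>The two-point and the three-point space with all nonzero distances equal to \<open>1\<close> are at
  distance at most \<open>D\<close>, where \<open>D \<boxplus> D = 1\<close>. Suppose that \<open>Z\<close> is a midpoint, so that it is
  \<open>\<epsilon>\<close>-interleaved with both for some \<open>\<epsilon>\<close> close to \<open>D / 2\<close>. Then two of the three points
  have images in \<open>Z\<close> that are sent to the same one of the two points, hence lie at distance at most
  \<open>\<epsilon> \<boxplus> \<epsilon>\<close> in \<open>Z\<close>. Going back to the three-point space, their distance is at most
  \<open>\<epsilon> \<boxplus> \<epsilon> \<boxplus> \<epsilon> < 1\<close>, so they coincide.\<close>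

lemma psum_nonneg:
  assumes "0 \<le> a" shows "0 \<le> psum p a b"
  using assms by (auto simp: psum_def)

lemma psum_mono_left:
  assumes "1 \<le> p" "0 \<le> a" "a \<le> a'"
  shows "psum p a b \<le> psum p a' b"
  using assms
  by (cases p) (auto simp: psum_def intro!: powr_mono2 add_mono)

lemma psum_0_left:
  assumes "1 \<le> p" "0 \<le> b" shows "psum p 0 b = b"
  using assms by (cases p) (auto simp: psum_def powr_powr)

lemma psum_ge_right:
  assumes "1 \<le> p" "0 \<le> a" "0 \<le> b" shows "b \<le> psum p a b"
  using psum_mono_left[of p 0 a b] psum_0_left[of p b] assms by simp

lemma mdist_self: "x \<in> mspace X \<Longrightarrow> mdist X x x = 0"
  by simp

text \<open>Constant maps satisfy the first interleaving condition for every \<open>\<epsilon>\<close>.\<close>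

lemma interleaved_bounded:
  assumes p: "1 \<le> p" and "0 \<le> \<epsilon>" and "mspace X \<noteq> {}" "mspace Y \<noteq> {}"
    and X: "\<And>x x'. x \<in> mspace X \<Longrightarrow> x' \<in> mspace X \<Longrightarrow> mdist X x x' \<le> psum p \<epsilon> \<epsilon>"
    and Y: "\<And>y y'. y \<in> mspace Y \<Longrightarrow> y' \<in> mspace Y \<Longrightarrow> mdist Y y y' \<le> psum p \<epsilon> \<epsilon>"
  shows "interleaved p \<epsilon> X Y"
proof -
  obtain x0 y0 where 0: "x0 \<in> mspace X" "y0 \<in> mspace Y" using assms by blast
  \<comment> \<open>Every height in the second interleaving condition is at least the assumed bound
    on the distances, so the blocks there are whole spaces.\<close>
  have ge: "psum p \<epsilon> \<epsilon> \<le> psum p (psum p t \<epsilon>) \<epsilon>" if "0 \<le> t" for t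
    using that assms by (intro psum_mono_left psum_ge_right)
  have bX: "dblock X (psum p (psum p t \<epsilon>) \<epsilon>) x = mspace X" if "0 \<le> t" "x \<in> mspace X" for t x
    using order_trans[OF X ge] that by (auto simp: dblock_def)
  have bY: "dblock Y (psum p (psum p t \<epsilon>) \<epsilon>) y = mspace Y" if "0 \<le> t" "y \<in> mspace Y" for t y
    using order_trans[OF Y ge] that by (auto simp: dblock_def)
  show ?thesis
    unfolding interleaved_def using 0 bX bY
    by (intro exI[of _ "\<lambda>_. y0"] exI[of _ "\<lambda>_. x0"]) (auto simp: dblock_def psum_nonneg mdist_self)
qed

lemma compact_ultrametric_bounded:
  assumes "compact_ultrametric X"
  obtains B where "0 < B" "\<And>x x'. x \<in> mspace X \<Longrightarrow> x' \<in> mspace X \<Longrightarrow> mdist X x x' \<le> B"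
proof -
  interpret M: Metric_space "mspace X" "mdist X" by simp
  have "M.mbounded (mspace X)"
    using assms M.compactin_imp_mbounded[of "mspace X"]
    by (simp add: compact_ultrametric_def compact_space_def mtopology_of_def)
  then show ?thesis using that unfolding M.mbounded_alt_pos by blast
qed

text \<open>A real infimum below \<open>r\<close> yields an element below \<open>r\<close> once the
  set is nonempty. Compactness bounds both spaces, and a positive common bound of all distances is
  an admissible \<epsilon> through constant maps.\<close>

lemma interleaving_distance_lessD:
  assumes p: "1 \<le> p" and X: "compact_ultrametric X" and Y: "compact_ultrametric Y"
    and "interleaving_distance p X Y < r"
  obtains \<epsilon> where "0 < \<epsilon>" "\<epsilon> < r" "interleaved p \<epsilon> X Y"
proof -
  obtain B where B: "0 < B" "\<And>x x'. x \<in> mspace X \<Longrightarrow> x' \<in> mspace X \<Longrightarrow> mdist X x x' \<le> B"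
    using compact_ultrametric_bounded[OF X] by blast
  obtain C where C: "0 < C" "\<And>y y'. y \<in> mspace Y \<Longrightarrow> y' \<in> mspace Y \<Longrightarrow> mdist Y y y' \<le> C"
    using compact_ultrametric_bounded[OF Y] by blast
  let ?m = "max B C"
  have m: "?m \<le> psum p ?m ?m" using p B by (intro psum_ge_right) auto
  have "interleaved p ?m X Y"
  proof (rule interleaved_bounded[OF p])
    show "mdist X x x' \<le> psum p ?m ?m" if "x \<in> mspace X" "x' \<in> mspace X" for x x'
      using B(2)[OF that] m by linarith
    show "mdist Y y y' \<le> psum p ?m ?m" if "y \<in> mspace Y" "y' \<in> mspace Y" for y y'
      using C(2)[OF that] m by linarith
  qed (use X Y B in \<open>auto simp: compact_ultrametric_def\<close>)
  then have "{\<epsilon>. \<epsilon> > 0 \<and> interleaved p \<epsilon> X Y} \<noteq> {}" using B(1) by (auto intro!: exI[of _ ?m])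
  from cInf_lessD[OF this] show ?thesis
    using assms(4) that unfolding interleaving_distance_def by auto
qed

lemma interleaving_distance_le:
  assumes "0 < \<epsilon>" "interleaved p \<epsilon> X Y"
  shows "interleaving_distance p X Y \<le> \<epsilon>"
  unfolding interleaving_distance_def
  by (rule cInf_lower) (use assms in \<open>auto intro!: bdd_belowI[of _ 0]\<close>)

text \<open>Lying in a block is a bound on a distance, so the dendrogram conditions turn into metric
  estimates.\<close>

lemma interleavedE:
  assumes p: "1 \<le> p" and "0 \<le> \<epsilon>" and "interleaved p \<epsilon> X Y" and "mspace X \<noteq> {}" "mspace Y \<noteq> {}"
  obtains \<phi> \<psi> where "\<phi> \<in> mspace X \<rightarrow> mspace Y" "\<psi> \<in> mspace Y \<rightarrow> mspace X"
    "\<And>x x' t. x \<in> mspace X \<Longrightarrow> x' \<in> mspace X \<Longrightarrow> mdist X x x' \<le> t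
      \<Longrightarrow> mdist Y (\<phi> x) (\<phi> x') \<le> psum p t \<epsilon>"
    "\<And>x. x \<in> mspace X \<Longrightarrow> mdist X (\<psi> (\<phi> x)) x \<le> psum p \<epsilon> \<epsilon>"
    "\<And>y. y \<in> mspace Y \<Longrightarrow> mdist Y (\<phi> (\<psi> y)) y \<le> psum p \<epsilon> \<epsilon>"
proof -
  obtain \<phi> \<psi> where f: "\<phi> \<in> mspace X \<rightarrow> mspace Y" and g: "\<psi> \<in> mspace Y \<rightarrow> mspace X"
    and all: "\<forall>t\<ge>0. \<forall>x\<in>mspace X. \<forall>y\<in>mspace Y.
        \<phi> ` dblock X t x \<subseteq> dblock Y (psum p t \<epsilon>) (\<phi> x) \<and>
        \<psi> ` dblock Y t y \<subseteq> dblock X (psum p t \<epsilon>) (\<psi> y) \<and>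
        dblock X (psum p (psum p t \<epsilon>) \<epsilon>) x = dblock X (psum p (psum p t \<epsilon>) \<epsilon>) (\<psi> (\<phi> x)) \<and>
        dblock Y (psum p (psum p t \<epsilon>) \<epsilon>) y = dblock Y (psum p (psum p t \<epsilon>) \<epsilon>) (\<phi> (\<psi> y))"
    using assms(3) unfolding interleaved_def by (elim exE conjE) (rule that)
  obtain x0 y0 where 0: "x0 \<in> mspace X" "y0 \<in> mspace Y" using assms by blast
  have pos: "0 \<le> psum p \<epsilon> \<epsilon>" using assms by (simp add: psum_nonneg)
  show ?thesis
  proof (rule that[OF f g])
    fix x x' t assume x: "x \<in> mspace X" "x' \<in> mspace X" "mdist X x x' \<le> t"
    have "0 \<le> t" using x(3) mdist_nonneg[of X x x'] by linarith
    then have "\<phi> ` dblock X t x \<subseteq> dblock Y (psum p t \<epsilon>) (\<phi> x)" using all x 0 by blast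
    then show "mdist Y (\<phi> x) (\<phi> x') \<le> psum p t \<epsilon>" using x by (auto simp: dblock_def)
  next
    fix x assume x: "x \<in> mspace X"
    \<comment> \<open>At height \<open>t = 0\<close> the radius becomes
      \<open>psum p \<epsilon> \<epsilon>\<close>. As \<open>x\<close> lies in its own block, it
      lies in that of \<open>\<psi> (\<phi> x)\<close>.\<close>
    have "dblock X (psum p \<epsilon> \<epsilon>) x = dblock X (psum p \<epsilon> \<epsilon>) (\<psi> (\<phi> x))"
      using all[rule_format, OF order_refl x 0(2)] psum_0_left[OF p assms(2)] by simp
    moreover have "x \<in> dblock X (psum p \<epsilon> \<epsilon>) x" using x pos by (simp add: dblock_def mdist_self)
    ultimately show "mdist X (\<psi> (\<phi> x)) x \<le> psum p \<epsilon> \<epsilon>" by (simp add: dblock_def)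
  next
    fix y assume y: "y \<in> mspace Y"
    have "dblock Y (psum p \<epsilon> \<epsilon>) y = dblock Y (psum p \<epsilon> \<epsilon>) (\<phi> (\<psi> y))"
      using all[rule_format, OF order_refl 0(1) y] psum_0_left[OF p assms(2)] by simp
    moreover have "y \<in> dblock Y (psum p \<epsilon> \<epsilon>) y" using y pos by (simp add: dblock_def mdist_self)
    ultimately show "mdist Y (\<phi> (\<psi> y)) y \<le> psum p \<epsilon> \<epsilon>" by (simp add: dblock_def)
  qed
qed

definition unit_simplex :: "'a set \<Rightarrow> 'a metric" where
  "unit_simplex S = metric (S, \<lambda>x y. if x = y then 0 else 1)"

lemma unit_simplex_metric: "Metric_space S (\<lambda>x y. if x = y then 0 else (1::real))"
  by unfold_locales auto

lemma mspace_unit_simplex [simp]: "mspace (unit_simplex S) = S"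
  and mdist_unit_simplex [simp]: "mdist (unit_simplex S) x y = (if x = y then 0 else 1)"
  unfolding unit_simplex_def
  by (simp_all add: Metric_space.mspace_metric[OF unit_simplex_metric]
      Metric_space.mdist_metric[OF unit_simplex_metric])

lemma compact_ultrametric_unit_simplex:
  assumes "finite S" "S \<noteq> {}"
  shows "compact_ultrametric (unit_simplex S)"
proof -
  have "compact_space (mtopology_of (unit_simplex S))"
    using assms by (simp add: compact_space_def finite_imp_compactin)
  then show ?thesis using assms(2) by (simp add: compact_ultrametric_def)
qed

text \<open>Pigeonhole as an injection from \<open>T\<close> through \<open>Z\<close> into
  \<open>S\<close>: points of \<open>T\<close> with the same image in \<open>S\<close> are close in
  \<open>Z\<close>, and returning to \<open>T\<close> keeps them closer than 1, the only nonzero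
  distance. The parameters \<epsilon> and \<delta> differ because two separate infima supply
  them.\<close>

lemma interleaved_unit_simplex_card_le:
  assumes p: "1 \<le> p" and Z: "compact_ultrametric Z"
    and fin: "finite S" "S \<noteq> {}" "T \<noteq> {}"
    and \<epsilon>: "0 \<le> \<epsilon>" "interleaved p \<epsilon> (unit_simplex S) Z"
    and \<delta>: "0 \<le> \<delta>" "interleaved p \<delta> Z (unit_simplex T)"
    and less: "psum p (psum p \<epsilon> \<epsilon>) \<delta> < 1" "psum p \<delta> \<delta> < 1"
  shows "card T \<le> card S"
proof -
  have ne: "mspace Z \<noteq> {}" using Z by (simp add: compact_ultrametric_def)
  obtain f g where fg: "f \<in> S \<rightarrow> mspace Z" "g \<in> mspace Z \<rightarrow> S"
    "\<And>z. z \<in> mspace Z \<Longrightarrow> mdist Z (f (g z)) z \<le> psum p \<epsilon> \<epsilon>"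
    by (rule interleavedE[OF p \<epsilon>]) (use fin ne in auto)
  obtain h k where hk: "h \<in> mspace Z \<rightarrow> T" "k \<in> T \<rightarrow> mspace Z"
    "\<And>z z' t. z \<in> mspace Z \<Longrightarrow> z' \<in> mspace Z \<Longrightarrow> mdist Z z z' \<le> t
      \<Longrightarrow> mdist (unit_simplex T) (h z) (h z') \<le> psum p t \<delta>"
    "\<And>y. y \<in> T \<Longrightarrow> mdist (unit_simplex T) (h (k y)) y \<le> psum p \<delta> \<delta>"
    by (rule interleavedE[OF p \<delta>]) (use fin ne in \<open>auto simp del: mdist_unit_simplex\<close>)
  \<comment> \<open>Distances in a unit simplex are 0 or 1, so a bound below 1 forces
    equality.\<close>
  have id: "h (k y) = y" if "y \<in> T" for y
    using hk(4)[OF that] less(2) by (auto split: if_splits)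
  have "inj_on (\<lambda>y. g (k y)) T"
  proof (rule inj_onI)
    fix y y' assume y: "y \<in> T" "y' \<in> T" and eq: "g (k y) = g (k y')"
    \<comment> \<open>By \<open>eq\<close>, both \<open>k y\<close> and \<open>k y'\<close> lie
      within \<open>psum p \<epsilon> \<epsilon>\<close> of \<open>w\<close>. The ultrametric
      inequality passes this bound to their distance without enlarging it.\<close>
    define w where "w = f (g (k y))"
    have k: "k y \<in> mspace Z" "k y' \<in> mspace Z" and w: "w \<in> mspace Z"
      using y hk fg by (auto simp: w_def Pi_iff)
    have "mdist Z (k y) (k y') \<le> max (mdist Z (k y) w) (mdist Z w (k y'))"
      using Z k w unfolding compact_ultrametric_def by blast
    also have "\<dots> \<le> psum p \<epsilon> \<epsilon>"
      using fg(3)[OF k(1)] fg(3)[OF k(2)] eq by (simp add: w_def mdist_commute[of Z "k y"])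
    finally have "mdist (unit_simplex T) (h (k y)) (h (k y')) < 1"
      using hk(3)[OF k] less(1) by (meson le_less_trans)
    then show "y = y'" using id y by (simp split: if_splits)
  qed
  moreover have "(\<lambda>y. g (k y)) ` T \<subseteq> S" using fg(2) hk(2) by auto
  ultimately show ?thesis using fin(1) by (rule card_inj_on_le)
qed

text \<open>The factor \<open>3/5\<close> leaves room above the midpoint value \<open>1/2\<close> and, for finite \<open>p\<close>, satisfies
  \<open>3 (3/5)\<^sup>p D\<^sup>p \<le> 9/10\<close>.\<close>

lemma psum_constants:
  assumes p: "1 \<le> p"
  obtains D where "0 < D" "psum p D D = 1"
    "\<And>\<epsilon> \<delta>. 0 < \<epsilon> \<Longrightarrow> \<epsilon> < 3/5 * D \<Longrightarrow> 0 < \<delta> \<Longrightarrow> \<delta> < 3/5 * D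
      \<Longrightarrow> psum p (psum p \<epsilon> \<epsilon>) \<delta> < 1 \<and> psum p \<delta> \<delta> < 1"
proof (cases p)
  case (real q)
  have q: "1 \<le> q" using p real by simp
  \<comment> \<open>Chosen to solve \<open>D powr q + D powr q = 1\<close>.\<close>
  define D :: real where "D = (1/2) powr (1/q)"
  have D: "D > 0" "D powr q = 1/2" using q by (simp_all add: D_def powr_powr)
  \<comment> \<open>For \<open>q \<ge> 1\<close> the power \<open>(3/5) powr q\<close> is at most
    3/5, and the factor \<open>D powr q = 1/2\<close> halves it.\<close>
  have small: "e powr q < 3/10" if "0 < e" "e < 3/5 * D" for e
  proof -
    have "e powr q < (3/5 * D) powr q" using that q by (intro powr_less_mono2) auto
    also have "\<dots> = (3/5) powr q / 2" using D by (simp only: powr_mult)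
    also have "(3/5::real) powr q \<le> (3/5) powr 1" using q by (intro powr_mono') auto
    finally show ?thesis by simp
  qed
  have root: "x powr (1/q) < 1" if "0 \<le> x" "x < 1" for x
    using that q powr_less_mono2[of "1/q" x 1] by simp
  show ?thesis
  proof (rule that[OF D(1)])
    show "psum p D D = 1" by (simp only: psum_def real real_of_ereal.simps D(2)) simp
    fix e d assume ed: "0 < e" "e < 3/5 * D" "0 < d" "d < 3/5 * D"
    \<comment> \<open>The outer power cancels the inner root, leaving sums of three and of two terms
      below 3/10 under a root.\<close>
    show "psum p (psum p e e) d < 1 \<and> psum p d d < 1"
      using small[OF ed(1,2)] small[OF ed(3,4)] q
      by (auto simp: psum_def real powr_powr intro!: root)
  qed
next
  case PInf
  \<comment> \<open>Here \<open>psum\<close> is the maximum, so \<open>D = 1\<close> and everything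
    below 3/5 stays below 1.\<close>
  show ?thesis by (rule that[of 1]) (auto simp: psum_def PInf)
next
  case MInf
  then show ?thesis using p by simp
qed

theorem proposition7p35:
  fixes p :: ereal
  assumes "1 \<le> p"
  shows "\<not> geodesic_space (UNIV :: ultra_class set) (class_distance p)"
proof
  assume geo: "geodesic_space (UNIV :: ultra_class set) (class_distance p)"
  define X Y :: "real metric" where "X = unit_simplex {0,1}" and "Y = unit_simplex {0,1,2}"
  have X: "compact_ultrametric X" and Y: "compact_ultrametric Y"
    by (simp_all add: X_def Y_def compact_ultrametric_unit_simplex)
  obtain D where D: "0 < D" "psum p D D = 1"
    "\<And>\<epsilon> \<delta>. 0 < \<epsilon> \<Longrightarrow> \<epsilon> < 3/5 * D \<Longrightarrow> 0 < \<delta> \<Longrightarrow> \<delta> < 3/5 * D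
      \<Longrightarrow> psum p (psum p \<epsilon> \<epsilon>) \<delta> < 1 \<and> psum p \<delta> \<delta> < 1"
    using psum_constants[OF assms] by blast
  \<comment> \<open>All distances are at most \<open>1 = psum p D D\<close>, so the criterion by
    constant maps applies.\<close>
  have "interleaved p D X Y"
    using D by (intro interleaved_bounded assms) (auto simp: X_def Y_def)
  then have le: "interleaving_distance p X Y \<le> D" using D by (intro interleaving_distance_le)
  let ?x = "abs_ultra_class X" and ?y = "abs_ultra_class Y"
  \<comment> \<open>The quotient is partial: evaluating the lifted distance requires representatives
    related to themselves, that is, compact ultrametric ones.\<close>
  have abs: "class_distance p (abs_ultra_class A) (abs_ultra_class B) = interleaving_distance p A B"
    if "compact_ultrametric A" "compact_ultrametric B" for A B
    using that by (simp add: class_distance.abs_eq isometric_cu_def isometric_refl)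
  obtain \<gamma> :: "real \<Rightarrow> ultra_class" where \<gamma>: "\<gamma> 0 = ?x" "\<gamma> 1 = ?y"
    "\<forall>s\<in>{0..1}. \<forall>t\<in>{0..1}. class_distance p (\<gamma> s) (\<gamma> t) = \<bar>s - t\<bar> * class_distance p ?x ?y"
    using geo unfolding geodesic_space_def by blast
  \<comment> \<open>The midpoint of the geodesic, represented by an actual space.\<close>
  obtain Z where Z: "compact_ultrametric Z" "\<gamma> (1/2) = abs_ultra_class Z"
    by (induct "\<gamma> (1/2)" rule: ultra_class.abs_induct) (auto simp: isometric_cu_def)
  have "class_distance p (\<gamma> 0) (\<gamma> (1/2)) = 1/2 * class_distance p ?x ?y"
    "class_distance p (\<gamma> (1/2)) (\<gamma> 1) = 1/2 * class_distance p ?x ?y"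
    using \<gamma>(3)[rule_format, of 0 "1/2"] \<gamma>(3)[rule_format, of "1/2" 1] by simp_all
  \<comment> \<open>Both halves are at most \<open>D / 2\<close>. The strict gap to
    \<open>3/5 * D\<close> makes it possible to pass from infima to actual interleavings.\<close>
  then have "interleaving_distance p X Z < 3/5 * D" "interleaving_distance p Z Y < 3/5 * D"
    using le D(1) by (simp_all add: \<gamma> Z abs X Y)
  then obtain \<epsilon> \<delta> where "0 < \<epsilon>" "\<epsilon> < 3/5 * D" "interleaved p \<epsilon> X Z"
    "0 < \<delta>" "\<delta> < 3/5 * D" "interleaved p \<delta> Z Y"
    by (metis interleaving_distance_lessD[OF assms X Z(1)] interleaving_distance_lessD[OF assms Z(1) Y])
  then have "card {0, 1, 2 :: real} \<le> card {0, 1 :: real}"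
    using D(3)[of \<epsilon> \<delta>] Z(1) assms unfolding X_def Y_def
    by (intro interleaved_unit_simplex_card_le[of p Z _ _ \<epsilon> \<delta>]) auto
  then show False by simp
qed

end
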